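(* Let $S=\begin{pmatrix}a&b\\c&d\end{pmatrix}$ and $T=\begin{pmatrix}\lambda&0\\0&\mu\end{pmatrix}$ be elements of $\mathrm{SL}(2,\mathbb H)$, where $\lambda$ is not similar to $\mu$. Suppose that $S$ and $T$ generate a discrete non-elementary subgroup of $\mathrm{SL}(2,\mathbb H)$. Then $$\{(\Re\lambda-\Re\mu)^2+(|\Im\lambda|+|\Im\mu|)^2\}\,(1+|bc|)\ \ge\ 1.$$
   Context: $\mathbb H$ is the division ring of real quaternions. For $q=q_0+q_1i+q_2j+q_3k\in\mathbb H$ ($q_0,\dots,q_3\in\mathbb R$): $\Re q=q_0$, $\Im q=q_1i+q_2j+q_3k$ (a quaternion), $\overline q=\Re q-\Im q$, $|q|=\sqrt{q_0^2+q_1^2+q_2^2+q_3^2}$. Two quaternions $p,q$ are similar if $q=u^{-1}pu$ for some nonzero $u\in\mathbb H$; equivalently $\Re p=\Re q$ and $|p|=|q|$. For a $2\times2$ quaternionic matrix $A=\begin{pmatrix}a&b\\c&d\end{pmatrix}$, $\det A=\sqrt{|a|^2|d|^2+|b|^2|c|^2-2\Re(a\overline c d\overline b)}$ (which equals $|ad-aca^{-1}b|$ when $a\ne0$); $\mathrm{SL}(2,\mathbb H)$ is the group of such matrices with $\det=1$. It acts on $\widehat{\mathbb H}=\mathbb H\cup\{\infty\}$ by $Z\mapsto(aZ+b)(cZ+d)^{-1}$, and by Poincaré extension on hyperbolic 5-space $\mathbf H^5$ (with boundary $\widehat{\mathbb H}$) by orientation-preserving isometries. A subgroup is elementary if it has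 a finite orbit in $\mathbf H^5\cup\widehat{\mathbb H}$, and non-elementary otherwise. *)

theory Defs
  imports "HOL-Analysis.Analysis" "HOL-Algebra.Generated_Groups"
begin

section \<open>Quaternions\<close>

datatype quat = Quat (qRe: real) (qI: real) (qJ: real) (qK: real)

lemma quat_eq_iff: "x = y \<longleftrightarrow> qRe x = qRe y \<and> qI x = qI y \<and> qJ x = qJ y \<and> qK x = qK y"
  by (cases x; cases y) auto

instantiation quat :: ring_1
begin

definition "0 = Quat 0 0 0 0"
definition "1 = Quat 1 0 0 0"
definition "x + y = Quat (qRe x + qRe y) (qI x + qI y) (qJ x + qJ y) (qK x + qK y)"
definition "x - y = Quat (qRe x - qRe y) (qI x - qI y) (qJ x - qJ y) (qK x - qK y)"
definition "- x = Quat (- qRe x) (- qI x) (- qJ x) (- qK x)"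
definition "x * y = Quat
  (qRe x * qRe y - qI x * qI y - qJ x * qJ y - qK x * qK y)
  (qRe x * qI y + qI x * qRe y + qJ x * qK y - qK x * qJ y)
  (qRe x * qJ y - qI x * qK y + qJ x * qRe y + qK x * qI y)
  (qRe x * qK y + qI x * qJ y - qJ x * qI y + qK x * qRe y)"

lemmas quat_arith_defs =
  zero_quat_def one_quat_def plus_quat_def minus_quat_def uminus_quat_def times_quat_def

instance
  by standard (auto simp: quat_arith_defs algebra_simps)

end

instantiation quat :: real_div_algebra
begin

definition "scaleR r x = Quat (r * qRe x) (r * qI x) (r * qJ x) (r * qK x)"
definition "inverse x =
  (let n = (qRe x)\<^sup>2 + (qI x)\<^sup>2 + (qJ x)\<^sup>2 + (qK x)\<^sup>2
   in Quat (qRe x / n) (- qI x / n) (- qJ x / n) (- qK x / n))"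
definition "x div y = x * inverse y" for x y :: quat

lemma quat_sumsq_eq_0_iff:
  "(qRe x)\<^sup>2 + (qI x)\<^sup>2 + (qJ x)\<^sup>2 + (qK x)\<^sup>2 = 0 \<longleftrightarrow> x = 0"
proof -
  have "(qRe x)\<^sup>2 + (qI x)\<^sup>2 + (qJ x)\<^sup>2 + (qK x)\<^sup>2 = 0 \<longleftrightarrow>
        qRe x = 0 \<and> qI x = 0 \<and> qJ x = 0 \<and> qK x = 0"
    by (simp add: add_nonneg_eq_0_iff)
  then show ?thesis by (simp add: quat_eq_iff zero_quat_def)
qed

instance
proof
  fix x :: quat assume "x \<noteq> 0"
  then have n: "(qRe x)\<^sup>2 + (qI x)\<^sup>2 + (qJ x)\<^sup>2 + (qK x)\<^sup>2 \<noteq> 0"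
    by (simp add: quat_sumsq_eq_0_iff)
  show "inverse x * x = 1" "x * inverse x = 1"
    using n by (simp_all add: inverse_quat_def Let_def times_quat_def one_quat_def
        add_divide_distrib [symmetric] diff_divide_distrib [symmetric] power2_eq_square algebra_simps)
next
  show "inverse (0::quat) = 0"
    by (simp add: inverse_quat_def zero_quat_def)
qed (auto simp: quat_arith_defs scaleR_quat_def divide_quat_def algebra_simps)

end

instantiation quat :: "{real_normed_div_algebra, real_inner}"
begin

definition "norm x = sqrt ((qRe x)\<^sup>2 + (qI x)\<^sup>2 + (qJ x)\<^sup>2 + (qK x)\<^sup>2)"
definition "inner x y = qRe x * qRe y + qI x * qI y + qJ x * qJ y + qK x * qK y"
definition "sgn x = x /\<^sub>R norm x" for x :: quat
definition "dist x y = norm (x - y)" for x y :: quat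
definition "(uniformity :: (quat \<times> quat) filter) =
  (INF e\<in>{0 <..}. principal {(x, y). dist x y < e})"
definition "open (U :: quat set) \<longleftrightarrow>
  (\<forall>x\<in>U. eventually (\<lambda>(x', y). x' = x \<longrightarrow> y \<in> U) uniformity)"

instance
proof
  fix r :: real and x y z :: quat
  show "norm x = 0 \<longleftrightarrow> x = 0"
    by (simp add: norm_quat_def quat_sumsq_eq_0_iff)
  have nL: "norm w = L2_set (\<lambda>i. [qRe w, qI w, qJ w, qK w] ! i) {..<4}" for w :: quat
    by (simp add: norm_quat_def L2_set_def numeral_eq_Suc lessThan_Suc add_ac)
  have "norm (x + y) = L2_set (\<lambda>i. [qRe x, qI x, qJ x, qK x] ! i + [qRe y, qI y, qJ y, qK y] ! i) {..<4}"
    by (simp add: norm_quat_def plus_quat_def L2_set_def numeral_eq_Suc lessThan_Suc add_ac)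
  also have "\<dots> \<le> norm x + norm y"
    unfolding nL by (rule L2_set_triangle_ineq)
  finally show "norm (x + y) \<le> norm x + norm y" .
  show "norm (scaleR r x) = \<bar>r\<bar> * norm x"
    by (simp add: norm_quat_def scaleR_quat_def power_mult_distrib distrib_left [symmetric] real_sqrt_mult)
  show "norm (x * y) = norm x * norm y"
    unfolding norm_quat_def real_sqrt_mult [symmetric]
    by (rule arg_cong [where f = sqrt]) (simp add: times_quat_def, algebra)
  show "inner x y = inner y x" "inner (x + y) z = inner x z + inner y z"
    "inner (scaleR r x) y = r * inner x y"
    by (simp_all add: inner_quat_def plus_quat_def scaleR_quat_def algebra_simps)
  show "0 \<le> inner x x" "norm x = sqrt (inner x x)"
    by (simp_all add: inner_quat_def norm_quat_def power2_eq_square)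
  have "inner x x = (qRe x)\<^sup>2 + (qI x)\<^sup>2 + (qJ x)\<^sup>2 + (qK x)\<^sup>2"
    by (simp add: inner_quat_def power2_eq_square)
  then show "inner x x = 0 \<longleftrightarrow> x = 0"
    by (simp add: quat_sumsq_eq_0_iff)
qed (simp_all add: sgn_quat_def dist_quat_def uniformity_quat_def open_quat_def)

end

definition qIm :: "quat \<Rightarrow> quat" where
  "qIm q = q - of_real (qRe q)"

definition qcnj :: "quat \<Rightarrow> quat" where
  "qcnj q = of_real (qRe q) - qIm q"

definition qsimilar :: "quat \<Rightarrow> quat \<Rightarrow> bool" where
  "qsimilar p q \<longleftrightarrow> (\<exists>u. u \<noteq> 0 \<and> q = inverse u * p * u)"


section \<open>The group \<open>SL(2,\<H>)\<close>\<close>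

definition mat2 :: "quat \<Rightarrow> quat \<Rightarrow> quat \<Rightarrow> quat \<Rightarrow> quat^2^2" where
  "mat2 a b c d = vector [vector [a, b], vector [c, d]]"

definition qdet :: "quat^2^2 \<Rightarrow> real" where
  "qdet A = (let a = A$1$1; b = A$1$2; c = A$2$1; d = A$2$2 in
     sqrt ((norm a)\<^sup>2 * (norm d)\<^sup>2 + (norm b)\<^sup>2 * (norm c)\<^sup>2 - 2 * qRe (a * qcnj c * d * qcnj b)))"

definition SL2H :: "(quat^2^2) monoid" where
  "SL2H = \<lparr>carrier = {A. qdet A = 1}, mult = (**), one = mat 1\<rparr>"


lemma mat2_nth [simp]:
  "mat2 a b c d $ 1 $ 1 = a" "mat2 a b c d $ 1 $ 2 = b"
  "mat2 a b c d $ 2 $ 1 = c" "mat2 a b c d $ 2 $ 2 = d"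
  by (simp_all add: mat2_def)

lemma mat2_collapse: "mat2 (A$1$1) (A$1$2) (A$2$1) (A$2$2) = A"
  by (simp add: vec_eq_iff forall_2)

lemma mat2_mult:
  "mat2 a b c d ** mat2 p q r w = mat2 (a*p + b*r) (a*q + b*w) (c*p + d*r) (c*q + d*w)"
  by (simp add: vec_eq_iff forall_2 matrix_matrix_mult_def sum_2)

lemma mat2_one: "mat 1 = mat2 1 0 0 1"
  by (simp add: vec_eq_iff forall_2 mat_def)

lemma qcnj_eq: "qcnj q = Quat (qRe q) (- qI q) (- qJ q) (- qK q)"
  by (simp add: qcnj_def qIm_def of_real_def scaleR_quat_def minus_quat_def one_quat_def)

lemma norm_quat_sq: "(norm q)\<^sup>2 = (qRe q)\<^sup>2 + (qI q)\<^sup>2 + (qJ q)\<^sup>2 + (qK q)\<^sup>2"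
  by (simp add: norm_quat_def)

text \<open>The polynomial under the root in \<^const>\<open>qdet\<close>; it occurs only in the proof of \<open>group_SL2H\<close>.\<close>

definition qdet2 :: "quat \<Rightarrow> quat \<Rightarrow> quat \<Rightarrow> quat \<Rightarrow> real" where
  "qdet2 a b c d =
     (norm a)\<^sup>2 * (norm d)\<^sup>2 + (norm b)\<^sup>2 * (norm c)\<^sup>2 - 2 * qRe (a * qcnj c * d * qcnj b)"

lemma qdet_mat2: "qdet (mat2 a b c d) = sqrt (qdet2 a b c d)"
  by (simp add: qdet_def qdet2_def Let_def)

lemma qcnj_mult: "qcnj (x * y) = qcnj y * qcnj x"
  by (simp add: qcnj_eq times_quat_def algebra_simps)

lemma qRe_mult_commute: "qRe (x * y) = qRe (y * x)"
  by (simp add: times_quat_def)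

lemma qcnj_norm: "qcnj x * x = of_real ((norm x)\<^sup>2)" "x * qcnj x = of_real ((norm x)\<^sup>2)"
  unfolding norm_quat_sq
  by (simp_all add: qcnj_eq times_quat_def of_real_def scaleR_quat_def one_quat_def
      power2_eq_square del: of_real_add of_real_mult of_real_power)

lemma qRe_of_real_mult [simp]: "qRe (of_real r * x) = r * qRe x" "qRe (x * of_real r) = r * qRe x"
  by (simp_all add: of_real_def scaleR_quat_def one_quat_def times_quat_def)

lemma qdet2_row: "qdet2 a b (c + x * a) (d + x * b) = qdet2 a b c d"
  by (simp add: qdet2_def norm_quat_sq qcnj_eq times_quat_def plus_quat_def, algebra)

lemma qdet2_swap: "qdet2 c d a b = qdet2 a b c d"
  by (simp add: qdet2_def norm_quat_sq qcnj_eq times_quat_def, algebra)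

lemma qdet2_row': "qdet2 (a + x * c) (b + x * d) c d = qdet2 a b c d"
  using qdet2_row qdet2_swap by metis

lemma qdet2_scale: "qdet2 (x * a) (x * b) (y * c) (y * d) = (norm x)\<^sup>2 * (norm y)\<^sup>2 * qdet2 a b c d"
proof -
  have "qRe (x * a * qcnj (y * c) * (y * d) * qcnj (x * b)) =
        qRe (x * (a * qcnj c * (qcnj y * y) * d * qcnj b * qcnj x))"
    by (simp add: qcnj_mult mult.assoc)
  also have "\<dots> = qRe (a * qcnj c * (qcnj y * y) * d * qcnj b * (qcnj x * x))"
    by (subst qRe_mult_commute) (simp add: mult.assoc)
  also have "\<dots> = (norm x)\<^sup>2 * ((norm y)\<^sup>2 * qRe (a * qcnj c * d * qcnj b))"
    unfolding qcnj_norm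
    by (simp add: times_quat_def of_real_def scaleR_quat_def one_quat_def algebra_simps)
  finally show ?thesis
    by (simp add: qdet2_def norm_mult power_mult_distrib algebra_simps)
qed

lemma qdet2_mult_aux:
  assumes "a \<noteq> 0"
  shows "qdet2 (a*p + b*r) (a*q + b*w) (c*p + d*r) (c*q + d*w) = qdet2 a b c d * qdet2 p q r w"
proof -
  define y where "y = inverse a * b"
  define e where "e = d - c * y"
  define x where "x = c * inverse a"
  have ay: "b = a * y" and xa: "c = x * a"
    using assms by (simp_all add: y_def x_def mult.assoc [symmetric]) (simp add: mult.assoc)
  have d: "d = e + x * b" by (simp add: e_def xa ay mult.assoc)
  have "qdet2 (a*p + b*r) (a*q + b*w) (c*p + d*r) (c*q + d*w)
      = qdet2 (a*p + b*r) (a*q + b*w) (e*r + x*(a*p + b*r)) (e*w + x*(a*q + b*w))"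
    unfolding d xa by (simp add: algebra_simps)
  also have "\<dots> = qdet2 (a*(p + y*r)) (a*(q + y*w)) (e*r) (e*w)"
    by (simp only: qdet2_row) (simp only: ay distrib_left mult.assoc)
  also have "\<dots> = (norm a)\<^sup>2 * (norm e)\<^sup>2 * qdet2 p q r w"
    by (simp only: qdet2_scale qdet2_row')
  also have "(norm a)\<^sup>2 * (norm e)\<^sup>2 = qdet2 a b 0 e"
    by (simp add: qdet2_def qcnj_eq zero_quat_def times_quat_def norm_quat_sq)
  also have "\<dots> = qdet2 a b c d"
    using qdet2_row[of a b 0 x e] by (simp add: d xa)
  finally show ?thesis .
qed

lemma qdet2_mult:
  "qdet2 (a*p + b*r) (a*q + b*w) (c*p + d*r) (c*q + d*w) = qdet2 a b c d * qdet2 p q r w"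
proof (cases "a = 0")
  case False
  then show ?thesis by (rule qdet2_mult_aux)
next
  case a: True
  show ?thesis
  proof (cases "c = 0")
    case False
    then show ?thesis using qdet2_mult_aux[of c p d r q w a b] by (simp add: qdet2_swap)
  next
    case True
    have z: "qdet2 0 0 r w = 0" for r w
      by (simp add: qdet2_def zero_quat_def times_quat_def norm_quat_sq)
    have "qdet2 (b*r) (b*w) (d*r) (d*w) = (norm b)\<^sup>2 * (norm d)\<^sup>2 * qdet2 (0 + 1 * r) (0 + 1 * w) r w"
      by (simp add: qdet2_scale)
    also have "\<dots> = 0" by (simp only: qdet2_row' z mult_zero_right)
    finally have "qdet2 (b*r) (b*w) (d*r) (d*w) = 0" .
    moreover have "qdet2 0 b 0 d = 0"
      by (simp add: qdet2_def zero_quat_def times_quat_def norm_quat_sq qcnj_eq)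
    ultimately show ?thesis using a True by simp
  qed
qed

lemma qdet_mult: "qdet (A ** B) = qdet A * qdet B"
proof -
  have "qdet (mat2 a b c d ** mat2 p q r w) = qdet (mat2 a b c d) * qdet (mat2 p q r w)" for a b c d p q r w
    by (simp add: mat2_mult qdet_mat2 qdet2_mult real_sqrt_mult)
  then show ?thesis by (metis mat2_collapse)
qed

lemma qdet_one: "qdet (mat 1) = 1"
  by (simp add: mat2_one qdet_mat2 qdet2_def) (simp add: zero_quat_def times_quat_def qcnj_eq)

lemma SL2H_right_inverse:
  assumes "qdet A = 1"
  shows "\<exists>B. qdet B = 1 \<and> A ** B = mat 1"
proof -
  obtain a b c d where A: "A = mat2 a b c d" by (metis mat2_collapse)
  have D: "qdet2 a b c d = 1" using assms by (simp add: A qdet_mat2)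
  define p where "p = (norm a)\<^sup>2 + (norm b)\<^sup>2"
  define r where "r = (norm c)\<^sup>2 + (norm d)\<^sup>2"
  define q where "q = a * qcnj c + b * qcnj d"
  have h: "of_real p = a * qcnj a + b * qcnj b" "of_real r = c * qcnj c + d * qcnj d"
    "qcnj q = c * qcnj a + d * qcnj b"
    by (simp_all add: p_def r_def q_def qcnj_norm)
      (simp add: qcnj_eq times_quat_def plus_quat_def algebra_simps)
  have n: "p * r - (norm q)\<^sup>2 = 1"
    using D unfolding p_def r_def q_def qdet2_def
    by (simp add: norm_quat_sq qcnj_eq times_quat_def plus_quat_def, algebra)
  define B where "B = mat2 (qcnj a) (qcnj c) (qcnj b) (qcnj d) ** mat2 (of_real r) (- q) (- qcnj q) (of_real p)"
  have com: "of_real t * x = x * of_real t" for t and x :: quat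
    by (simp add: of_real_def)
  have "A ** mat2 (qcnj a) (qcnj c) (qcnj b) (qcnj d) = mat2 (of_real p) q (qcnj q) (of_real r)"
    unfolding A mat2_mult h by (simp only: q_def)
  then have "A ** B = mat2 (of_real p) q (qcnj q) (of_real r) ** mat2 (of_real r) (- q) (- qcnj q) (of_real p)"
    unfolding B_def matrix_mul_assoc by simp
  also have "\<dots> = mat2 (of_real (p * r - (norm q)\<^sup>2)) 0 0 (of_real (p * r - (norm q)\<^sup>2))"
    by (simp add: mat2_mult qcnj_norm com[of p q] com[of r "qcnj q"] com[of p "of_real r"])
  finally have AB: "A ** B = mat 1" by (simp add: n mat2_one)
  then have "qdet A * qdet B = 1" by (metis qdet_mult qdet_one)
  with assms AB show ?thesis by auto
qed

lemma group_SL2H: "group SL2H"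
proof (rule groupI)
  fix A assume "A \<in> carrier SL2H"
  then have A: "qdet A = 1" by (simp add: SL2H_def)
  then obtain B where B: "qdet B = 1" "A ** B = mat 1" using SL2H_right_inverse by blast
  then obtain C where C: "B ** C = mat 1" using SL2H_right_inverse by blast
  have "A = C" by (metis B(2) C matrix_mul_assoc matrix_mul_lid matrix_mul_rid)
  with B C show "\<exists>B\<in>carrier SL2H. B \<otimes>\<^bsub>SL2H\<^esub> A = \<one>\<^bsub>SL2H\<^esub>" by (auto simp: SL2H_def)
qed (auto simp: SL2H_def qdet_mult qdet_one matrix_mul_assoc)


section \<open>Actions on the boundary and on hyperbolic 5-space\<close>

text \<open>The boundary is \<open>\<H> \<union> {\<infinity>}\<close>, with \<^const>\<open>None\<close> standing for \<open>\<infinity>\<close>.\<close>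

definition moebius :: "quat^2^2 \<Rightarrow> quat option \<Rightarrow> quat option" where
  "moebius A Z = (let a = A$1$1; b = A$1$2; c = A$2$1; d = A$2$2 in
     case Z of
       None \<Rightarrow> if c = 0 then None else Some (a * inverse c)
     | Some z \<Rightarrow> if c * z + d = 0 then None else Some ((a * z + b) * inverse (c * z + d)))"

text \<open>Upper half-space model: \<open>(z, t)\<close> is the point at height \<open>t > 0\<close> above \<open>z \<in> \<H>\<close>.\<close>

definition hyp5 :: "(quat \<times> real) set" where
  "hyp5 = {(z, t). t > 0}"

text \<open>
  The explicit formula for the Poincare extension.  At \<open>t = 0\<close> the first component becomes
  \<open>(a z + b) (c z + d)\<^sup>-\<^sup>1\<close>, since \<open>q\<^sup>-\<^sup>1 = qcnj q / |q|\<^sup>2\<close>.  Under the correspondence of \<open>(z, t)\<close>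
  with the positive definite Hermitian matrix \<open>X = t\<^sup>-\<^sup>1 (|z|\<^sup>2 + t\<^sup>2, z; qcnj z, 1)\<close> of determinant
  \<open>1\<close>, it is the isometric action \<open>X \<mapsto> A X A\<^sup>*\<close>.
\<close>

definition poincare :: "quat^2^2 \<Rightarrow> quat \<times> real \<Rightarrow> quat \<times> real" where
  "poincare A p = (let a = A$1$1; b = A$1$2; c = A$2$1; d = A$2$2; z = fst p; t = snd p;
       n = (norm (c * z + d))\<^sup>2 + (norm c)\<^sup>2 * t\<^sup>2 in
     (((a * z + b) * qcnj (c * z + d) + t\<^sup>2 *\<^sub>R (a * qcnj c)) /\<^sub>R n, t / n))"

definition elementary :: "(quat^2^2) set \<Rightarrow> bool" where
  "elementary G \<longleftrightarrow>
     (\<exists>p\<in>hyp5. finite ((\<lambda>A. poincare A p) ` G)) \<or> (\<exists>Z. finite ((\<lambda>A. moebius A Z) ` G))"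

end

(* A Jorgensen-type argument. If the inequality fails, iterate S_0 = S,
   S_{n+1} = S_n T S_n^{-1}. Conjugates of mu stay within k < 1 of lam, where k^2 is the factor in
   braces, so |b_{n+1}| <= k |a_n b_n| and |c_{n+1}| <= k |c_n d_n|; with |a_n d_n| <= 1 + |b_n c_n|
   the products |b_n c_n| decrease to 0 and the diagonal entries stay bounded. Hence
   |b_n| / |lam|^n and |c_n| / |mu|^n tend to 0, and the bounded sequence T^{-n} S_{2n} T^n has
   off-diagonal entries tending to 0. By discreteness some S_{2n} is diagonal. As lam and mu
   are not similar and the real trace of an antidiagonal S_n with n >= 1 would vanish, going back
   shows that S is diagonal or antidiagonal, so the group permutes {0, infinity}. *)

theory Submission
  imports Defs
begin

section \<open>Quaternions: conjugates of a point and twisted sums\<close>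

section \<open>Quaternions\<close>

text \<open>Provides compactness: bounded sequences of quaternionic matrices have convergent
  subsequences.\<close>

instantiation quat :: euclidean_space
begin

definition "Basis = {Quat 1 0 0 0, Quat 0 1 0 0, Quat 0 0 1 0, Quat 0 0 0 1}"

instance
proof
  show "(Basis :: quat set) \<noteq> {}" "finite (Basis :: quat set)"
    by (simp_all add: Basis_quat_def)
next
  fix u v :: quat
  assume "u \<in> Basis" "v \<in> Basis"
  then show "inner u v = (if u = v then 1 else 0)"
    unfolding Basis_quat_def by (elim insertE emptyE; hypsubst; simp add: inner_quat_def)
next
  fix x :: quat
  show "(\<forall>u\<in>Basis. inner x u = 0) \<longleftrightarrow> x = 0"
    unfolding quat_eq_iff [of x] by (simp add: Basis_quat_def inner_quat_def zero_quat_def)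
qed

end

lemma qRe_add [simp]: "qRe (x + y) = qRe x + qRe y"
  by (simp add: plus_quat_def)

lemma norm_qcnj [simp]: "norm (qcnj x) = norm x"
  by (simp add: norm_quat_def qcnj_eq)

lemma qRe_zero [simp]: "qRe 0 = 0"
  by (simp add: zero_quat_def)

lemma qcnj_zero [simp]: "qcnj 0 = 0"
  by (simp add: qcnj_eq zero_quat_def)

lemma abs_qRe_le_norm: "\<bar>qRe x\<bar> \<le> norm x"
  unfolding norm_quat_def by (rule real_le_rsqrt) simp

lemma qRe_conj: "w \<noteq> 0 \<Longrightarrow> qRe (w * x * inverse w) = qRe x" for w :: quat
  by (subst qRe_mult_commute) (simp add: mult.assoc [symmetric])

lemma of_real_quat_commute: "of_real r * x = x * of_real r" for x :: quat
  by (simp add: of_real_def)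

lemma qIm_conj: "w \<noteq> 0 \<Longrightarrow> qIm (w * x * inverse w) = w * qIm x * inverse w" for w :: quat
  by (simp add: qIm_def qRe_conj left_diff_distrib right_diff_distrib of_real_quat_commute [of _ w, symmetric])
    (simp add: mult.assoc)

lemma norm_sq_eq_qRe_qIm: "(norm x)\<^sup>2 = (qRe x)\<^sup>2 + (norm (qIm x))\<^sup>2"
  by (simp add: norm_quat_sq qIm_def minus_quat_def of_real_def scaleR_quat_def one_quat_def)

text \<open>The square of the largest distance from \<open>p\<close> to a conjugate of
  \<open>q\<close>: the imaginary parts of these conjugates fill a sphere about 0 of radius
  \<open>norm (qIm q)\<close>, and the farthest point lies opposite \<open>qIm p\<close>.\<close>

definition conj_gap :: "quat \<Rightarrow> quat \<Rightarrow> real" where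
  "conj_gap p q = (qRe p - qRe q)\<^sup>2 + (norm (qIm p) + norm (qIm q))\<^sup>2"

lemma conj_gap_nonneg: "0 \<le> conj_gap p q"
  by (simp add: conj_gap_def)

text \<open>Conjugation preserves the real part and the norm of the imaginary part, so only the
  angle between the imaginary parts is unknown; the triangle inequality covers the worst
  angle.\<close>

lemma norm_diff_conj_le:
  assumes "w \<noteq> 0"
  shows "norm (p - w * q * inverse w) \<le> sqrt (conj_gap p q)"
proof -
  define v where "v = w * q * inverse w"
  have re: "qRe v = qRe q" and im: "norm (qIm v) = norm (qIm q)"
    using assms by (simp_all add: v_def qRe_conj qIm_conj norm_mult norm_inverse)
  have "qIm (p - v) = qIm p - qIm v" "qRe (p - v) = qRe p - qRe v"
    by (simp_all add: qIm_def minus_quat_def of_real_def scaleR_quat_def one_quat_def)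
  then have "(norm (p - v))\<^sup>2 = (qRe p - qRe q)\<^sup>2 + (norm (qIm p - qIm v))\<^sup>2"
    by (simp add: norm_sq_eq_qRe_qIm [of "p - v"] re)
  also have "\<dots> \<le> conj_gap p q"
    unfolding conj_gap_def using norm_triangle_ineq4[of "qIm p" "qIm v"] by (simp add: im power_mono)
  finally show ?thesis
    unfolding v_def by (rule real_le_rsqrt)
qed

text \<open>Solving the relation for \<open>v\<close> turns \<open>y * q * v\<close> into
  \<open>- x * (w * q * inverse w) * u\<close>. The off-diagonal entries of a conjugated diagonal
  matrix are sums of this shape.\<close>

lemma twisted_sum_factor:
  fixes p q x y u v :: quat
  assumes "x \<noteq> 0" "y \<noteq> 0" "x * u + y * v = 0"
  defines "w \<equiv> inverse x * y"
  shows "x * p * u + y * q * v = x * (p - w * q * inverse w) * u"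
proof -
  have "v = - (inverse y * (x * u))"
    using assms(2,3) by (metis left_inverse minus_mult_right mult.assoc mult_1 neg_eq_iff_add_eq_0)
  then show ?thesis
    using assms(1,2) unfolding w_def
    by (simp add: algebra_simps nonzero_inverse_mult_distrib flip: mult.assoc)
qed

lemma norm_twisted_sum_le:
  fixes p q x y u v :: quat
  assumes "x * u + y * v = 0"
  shows "norm (x * p * u + y * q * v) \<le> sqrt (conj_gap p q) * norm (x * u)"
proof (cases "x = 0 \<or> y = 0")
  case True
  then have "x * u = 0 \<and> y * v = 0"
    using assms by auto
  then show ?thesis
    by (auto simp: conj_gap_nonneg)
next
  case False
  then have "inverse x * y \<noteq> 0" by simp
  from norm_diff_conj_le[OF this, of p q] False show ?thesis
    using twisted_sum_factor[of x y u v p q] assms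
    by (simp add: norm_mult mult.assoc mult_left_mono mult_right_mono mult.left_commute)
qed

text \<open>If \<open>x * u\<close> were nonzero, the factored form would force
  \<open>p = w * q * inverse w\<close>, making \<open>p\<close> and \<open>q\<close>
  similar.\<close>

lemma twisted_sum_nonzero:
  fixes p q x y u v :: quat
  assumes "\<not> qsimilar p q" and "x * u + y * v = 0" and "x * p * u + y * q * v = 0"
  shows "x * u = 0"
proof (rule ccontr)
  assume nz: "x * u \<noteq> 0"
  then have xy: "x \<noteq> 0" "y \<noteq> 0" "u \<noteq> 0"
    using assms(2) by auto
  define w where "w = inverse x * y"
  have w: "w \<noteq> 0" using xy by (simp add: w_def)
  have "x * (p - w * q * inverse w) * u = 0"
    using twisted_sum_factor[OF xy(1,2) assms(2), of p q] assms(3) by (simp add: w_def)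
  then have "p = w * q * inverse w" using xy by simp
  then have "q = inverse w * p * w"
    using w by (metis left_inverse mult.assoc mult.right_neutral mult_1)
  then show False using assms(1) w unfolding qsimilar_def by blast
qed

section \<open>Matrices: entry norms and zero patterns under conjugation of a diagonal
  matrix\<close>

section \<open>Matrices\<close>

lemma qdet_eq_1_iff: "qdet A = 1 \<longleftrightarrow> qdet2 (A$1$1) (A$1$2) (A$2$1) (A$2$2) = 1"
  using qdet_mat2[of "A$1$1" "A$1$2" "A$2$1" "A$2$2"] by (simp add: mat2_collapse)

lemma mat2_eq_iff: "mat2 a b c d = mat2 p q r w \<longleftrightarrow> a = p \<and> b = q \<and> c = r \<and> d = w"
  by (metis mat2_nth)

text \<open>Bounding the real part in the determinant by the product of the norms gives (|ad| -
  |bc|)^2 \<le> 1.\<close>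

lemma SL2H_diag_le:
  assumes "qdet A = 1"
  shows "norm (A$1$1) * norm (A$2$2) \<le> 1 + norm (A$1$2) * norm (A$2$1)"
proof -
  let ?x = "norm (A$1$1) * norm (A$2$2)" and ?y = "norm (A$1$2) * norm (A$2$1)"
  have "qRe (A$1$1 * qcnj (A$2$1) * A$2$2 * qcnj (A$1$2)) \<le> ?x * ?y"
    using abs_qRe_le_norm[of "A$1$1 * qcnj (A$2$1) * A$2$2 * qcnj (A$1$2)"]
    by (simp add: norm_mult mult_ac)
  then have "(?x - ?y)\<^sup>2 \<le> 1"
    using assms unfolding qdet_eq_1_iff qdet2_def by (simp add: power2_eq_square algebra_simps)
  then have "?x - ?y \<le> 1"
    by (simp add: abs_square_le_1 abs_le_iff)
  then show ?thesis by simp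
qed

text \<open>Multiply \<open>A\<close> by a matrix with one column of \<open>B = A\<^sup>-\<^sup>1\<close> and one
  standard basis column, and take determinants.\<close>

lemma SL2H_inverse_norms:
  assumes AB: "A ** B = mat 1" and A: "qdet A = 1"
  shows "norm (B$1$1) = norm (A$2$2)" "norm (B$1$2) = norm (A$1$2)"
    "norm (B$2$1) = norm (A$2$1)" "norm (B$2$2) = norm (A$1$1)"
proof -
  let ?a = "A$1$1" and ?b = "A$1$2" and ?c = "A$2$1" and ?d = "A$2$2"
  have "mat2 ?a ?b ?c ?d ** mat2 (B$1$1) (B$1$2) (B$2$1) (B$2$2) = mat2 1 0 0 1"
    using AB by (simp add: mat2_collapse mat2_one)
  then have e: "?a * B$1$1 + ?b * B$2$1 = 1" "?a * B$1$2 + ?b * B$2$2 = 0"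
    "?c * B$1$1 + ?d * B$2$1 = 0" "?c * B$1$2 + ?d * B$2$2 = 1"
    by (simp_all add: mat2_mult mat2_eq_iff)
  note D = A[unfolded qdet_eq_1_iff]
  have t: "qdet2 1 p 0 q = (norm q)\<^sup>2" "qdet2 p 0 q 1 = (norm p)\<^sup>2" "qdet2 0 p 1 q = (norm p)\<^sup>2"
    "qdet2 p 1 q 0 = (norm q)\<^sup>2" for p q
    by (simp_all add: qdet2_def)
  have sq: "norm p = norm q" if "(norm p)\<^sup>2 = (norm q)\<^sup>2" for p q :: quat
    using that by simp
  show "norm (B$1$1) = norm ?d"
    using qdet2_mult[of ?a 0 ?b 1 "B$1$1" "B$2$1" ?c ?d] D e by (intro sq) (simp add: t)
  show "norm (B$1$2) = norm ?b"
    using qdet2_mult[of ?a 0 ?b 1 "B$1$2" "B$2$2" ?c ?d] D e by (intro sq) (simp add: t)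
  show "norm (B$2$1) = norm ?c"
    using qdet2_mult[of ?a 1 ?b 0 "B$1$1" "B$2$1" ?c ?d] D e by (intro sq) (simp add: t)
  show "norm (B$2$2) = norm ?a"
    using qdet2_mult[of ?a 1 ?b 0 "B$1$2" "B$2$2" ?c ?d] D e by (intro sq) (simp add: t)
qed

lemma SL2H_inverse_commute:
  assumes "A ** B = mat 1" and "qdet A = 1"
  shows "B ** A = mat 1"
proof -
  have "qdet B = 1"
    using assms qdet_mult[of A B] by (simp add: qdet_one)
  then obtain C where C: "B ** C = mat 1" using SL2H_right_inverse by blast
  have "A = C" by (metis assms(1) C matrix_mul_assoc matrix_mul_lid matrix_mul_rid)
  with C show ?thesis by simp
qed

lemma inv_SL2H:
  assumes "qdet A = 1"
  shows "A ** inv\<^bsub>SL2H\<^esub> A = mat 1" "qdet (inv\<^bsub>SL2H\<^esub> A) = 1"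
proof -
  interpret group SL2H by (rule group_SL2H)
  have A: "A \<in> carrier SL2H" using assms by (simp add: SL2H_def)
  show "A ** inv\<^bsub>SL2H\<^esub> A = mat 1" using r_inv[OF A] by (simp add: SL2H_def)
  show "qdet (inv\<^bsub>SL2H\<^esub> A) = 1" using inv_closed[OF A] by (simp add: SL2H_def)
qed

text \<open>These are the relations \<open>x * u + y * v = 0\<close> that the twisted sums
  require.\<close>

lemma mat2_mult_eq_one_offdiag:
  fixes A B :: "quat^2^2"
  assumes "A ** B = mat 1"
  shows "A$1$1 * B$1$2 + A$1$2 * B$2$2 = 0" "A$2$1 * B$1$1 + A$2$2 * B$2$1 = 0"
proof -
  have "mat2 (A$1$1) (A$1$2) (A$2$1) (A$2$2) ** mat2 (B$1$1) (B$1$2) (B$2$1) (B$2$2) = mat2 1 0 0 1"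
    using assms by (simp add: mat2_collapse mat2_one)
  then show "A$1$1 * B$1$2 + A$1$2 * B$2$2 = 0" "A$2$1 * B$1$1 + A$2$2 * B$2$1 = 0"
    by (simp_all add: mat2_mult mat2_eq_iff)
qed

lemma sandwich_diag_entries:
  fixes A B :: "quat^2^2" and p q :: quat
  defines "C \<equiv> A ** mat2 p 0 0 q ** B"
  shows "C$1$1 = A$1$1 * p * B$1$1 + A$1$2 * q * B$2$1"
    "C$1$2 = A$1$1 * p * B$1$2 + A$1$2 * q * B$2$2"
    "C$2$1 = A$2$1 * p * B$1$1 + A$2$2 * q * B$2$1"
    "C$2$2 = A$2$1 * p * B$1$2 + A$2$2 * q * B$2$2"
proof -
  have "C = mat2 (A$1$1) (A$1$2) (A$2$1) (A$2$2) ** mat2 p 0 0 q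
      ** mat2 (B$1$1) (B$1$2) (B$2$1) (B$2$2)"
    by (simp add: C_def mat2_collapse)
  then show "C$1$1 = A$1$1 * p * B$1$1 + A$1$2 * q * B$2$1"
    "C$1$2 = A$1$1 * p * B$1$2 + A$1$2 * q * B$2$2"
    "C$2$1 = A$2$1 * p * B$1$1 + A$2$2 * q * B$2$1"
    "C$2$2 = A$2$1 * p * B$1$2 + A$2$2 * q * B$2$2"
    by (simp_all add: mat2_mult)
qed

text \<open>One step of the iteration. Off-diagonal entries are twisted sums, whose factor
  \<open>u\<close> has the norm of an entry of \<open>A\<close>; diagonal entries need only the
  triangle inequality and |ad| \<le> 1 + |bc|.\<close>

lemma conj_diag_bounds:
  fixes p q :: quat
  assumes AB: "A ** B = mat 1" and A: "qdet A = 1"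
  defines "C \<equiv> A ** mat2 p 0 0 q ** B" and "t \<equiv> norm (A$1$2) * norm (A$2$1)"
  shows "norm (C$1$2) \<le> sqrt (conj_gap p q) * norm (A$1$1) * norm (A$1$2)"
    "norm (C$2$1) \<le> sqrt (conj_gap p q) * norm (A$2$2) * norm (A$2$1)"
    "norm (C$1$1) \<le> norm p * (1 + t) + norm q * t"
    "norm (C$2$2) \<le> norm p * t + norm q * (1 + t)"
proof -
  note e = sandwich_diag_entries[of A p q B, folded C_def]
  note off = mat2_mult_eq_one_offdiag[OF AB]
  note n = SL2H_inverse_norms[OF AB A]
  have le: "norm (A$1$1) * norm (A$2$2) \<le> 1 + t"
    using SL2H_diag_le[OF A] by (simp add: t_def)
  show "norm (C$1$2) \<le> sqrt (conj_gap p q) * norm (A$1$1) * norm (A$1$2)"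
    using norm_twisted_sum_le[OF off(1), of p q] by (simp add: e(2) norm_mult n mult.assoc)
  show "norm (C$2$1) \<le> sqrt (conj_gap p q) * norm (A$2$2) * norm (A$2$1)"
    using norm_twisted_sum_le[OF off(2), of p q] by (simp add: e(3) norm_mult n mult_ac)
  have "norm (C$1$1) \<le> norm p * (norm (A$1$1) * norm (A$2$2)) + norm q * t"
    unfolding e(1) using norm_triangle_ineq[of "A$1$1 * p * B$1$1" "A$1$2 * q * B$2$1"]
    by (simp add: norm_mult n t_def mult_ac)
  also have "\<dots> \<le> norm p * (1 + t) + norm q * t"
    using le by (simp add: mult_left_mono)
  finally show "norm (C$1$1) \<le> norm p * (1 + t) + norm q * t" .
  have "norm (C$2$2) \<le> norm p * t + norm q * (norm (A$1$1) * norm (A$2$2))"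
    unfolding e(4) using norm_triangle_ineq[of "A$2$1 * p * B$1$2" "A$2$2 * q * B$2$2"]
    by (simp add: norm_mult n t_def mult_ac)
  also have "\<dots> \<le> norm p * t + norm q * (1 + t)"
    using le by (simp add: mult_left_mono)
  finally show "norm (C$2$2) \<le> norm p * t + norm q * (1 + t)" .
qed

definition diag2 :: "quat^2^2 \<Rightarrow> bool" where
  "diag2 A \<longleftrightarrow> A$1$2 = 0 \<and> A$2$1 = 0"

definition antidiag2 :: "quat^2^2 \<Rightarrow> bool" where
  "antidiag2 A \<longleftrightarrow> A$1$1 = 0 \<and> A$2$2 = 0"

text \<open>By non-similarity each row of \<open>A\<close> contains a zero. The real part in the
  determinant then vanishes, so ad or bc is nonzero, which leaves only the two patterns.\<close>

lemma conj_diag_diag2: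
  fixes p q :: quat
  assumes AB: "A ** B = mat 1" and A: "qdet A = 1" and "\<not> qsimilar p q"
    and C: "diag2 (A ** mat2 p 0 0 q ** B)"
  shows "diag2 A \<or> antidiag2 A"
proof -
  note e = sandwich_diag_entries[of A p q B]
  note off = mat2_mult_eq_one_offdiag[OF AB]
  note n = SL2H_inverse_norms[OF AB A]
  have "A$1$1 * B$1$2 = 0" "A$2$1 * B$1$1 = 0"
    using twisted_sum_nonzero[OF assms(3) off(1)] twisted_sum_nonzero[OF assms(3) off(2)] C e(2,3)
    by (simp_all add: diag2_def)
  moreover have "B$1$2 = 0 \<longleftrightarrow> A$1$2 = 0" "B$1$1 = 0 \<longleftrightarrow> A$2$2 = 0"
    by (metis n norm_eq_zero)+
  ultimately have *: "A$1$1 = 0 \<or> A$1$2 = 0" "A$2$1 = 0 \<or> A$2$2 = 0"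
    by auto
  have "qRe (A$1$1 * qcnj (A$2$1) * A$2$2 * qcnj (A$1$2)) = 0"
    using * by (auto simp: qcnj_eq times_quat_def zero_quat_def)
  then have "(norm (A$1$1))\<^sup>2 * (norm (A$2$2))\<^sup>2 + (norm (A$1$2))\<^sup>2 * (norm (A$2$1))\<^sup>2 = 1"
    using A unfolding qdet_eq_1_iff qdet2_def by simp
  then show ?thesis
    using * unfolding diag2_def antidiag2_def by auto
qed

text \<open>The trace itself is not conjugation invariant over the quaternions, but its real part
  is, since \<open>qRe\<close> of a product is invariant under cyclic rotation.\<close>

lemma qRe_trace_conj:
  fixes p q :: quat
  assumes AB: "A ** B = mat 1" and A: "qdet A = 1"
  defines "C \<equiv> A ** mat2 p 0 0 q ** B"
  shows "qRe (C$1$1 + C$2$2) = qRe p + qRe q"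
proof -
  note e = sandwich_diag_entries[of A p q B, folded C_def]
  have "mat2 (B$1$1) (B$1$2) (B$2$1) (B$2$2) ** mat2 (A$1$1) (A$1$2) (A$2$1) (A$2$2) = mat2 1 0 0 1"
    using SL2H_inverse_commute[OF AB A] by (simp add: mat2_collapse mat2_one)
  then have f: "B$1$1 * A$1$1 + B$1$2 * A$2$1 = 1" "B$2$1 * A$1$2 + B$2$2 * A$2$2 = 1"
    by (simp_all add: mat2_mult mat2_eq_iff)
  have r: "qRe (x * y * z) = qRe (z * x * y)" for x y z
    by (metis mult.assoc qRe_mult_commute)
  have "qRe (C$1$1 + C$2$2) = qRe ((B$1$1 * A$1$1 + B$1$2 * A$2$1) * p)
      + qRe ((B$2$1 * A$1$2 + B$2$2 * A$2$2) * q)"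
    unfolding e(1,4) distrib_right qRe_add
      r[of "A$1$1"] r[of "A$1$2"] r[of "A$2$1"] r[of "A$2$2"] by simp
  then show ?thesis by (simp add: f)
qed

text \<open>With vanishing real trace, \<open>conj_gap p q \<ge> |p|\<^sup>2 + |q|\<^sup>2 \<ge> 2 |p| |q| = 2\<close>.\<close>

lemma conj_diag_not_antidiag2:
  fixes p q :: quat
  assumes AB: "A ** B = mat 1" and A: "qdet A = 1"
    and pq: "norm p * norm q = 1" and gap: "conj_gap p q < 1"
  shows "\<not> antidiag2 (A ** mat2 p 0 0 q ** B)"
proof
  assume "antidiag2 (A ** mat2 p 0 0 q ** B)"
  then have re: "qRe q = - qRe p"
    using qRe_trace_conj[OF AB A, of p q] by (simp add: antidiag2_def)
  have "2 = 2 * (norm p * norm q)" by (simp add: pq)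
  also have "\<dots> \<le> (norm p)\<^sup>2 + (norm q)\<^sup>2"
    using sum_squares_bound[of "norm p" "norm q"] by simp
  also have "\<dots> \<le> conj_gap p q"
    unfolding norm_sq_eq_qRe_qIm [of p] norm_sq_eq_qRe_qIm [of q] conj_gap_def re
    by (simp add: power2_eq_square algebra_simps)
  finally show False using gap by simp
qed

section \<open>Groups: a criterion for being elementary, and bounded sequences under
  discreteness\<close>

section \<open>Elementary and discrete subgroups\<close>

text \<open>The two patterns together are closed under products and, by the entry norms of an
  inverse, under inverses. Such matrices map infinity to infinity or 0, so its orbit is
  finite.\<close>

lemma elementary_generate_diag_antidiag:
  assumes H: "H \<subseteq> carrier SL2H" and "\<And>A. A \<in> H \<Longrightarrow> diag2 A \<or> antidiag2 A"
  shows "elementary (generate SL2H H)"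
proof -
  have "diag2 A \<or> antidiag2 A" if "A \<in> generate SL2H H" for A
    using that
  proof induction
    case one
    show ?case by (simp add: SL2H_def mat2_one diag2_def)
  next
    case (incl h)
    then show ?case using assms(2) by blast
  next
    case (inv h)
    then have "qdet h = 1" using H by (auto simp: SL2H_def)
    then have n: "norm ((inv\<^bsub>SL2H\<^esub> h)$1$1) = norm (h$2$2)" "norm ((inv\<^bsub>SL2H\<^esub> h)$1$2) = norm (h$1$2)"
      "norm ((inv\<^bsub>SL2H\<^esub> h)$2$1) = norm (h$2$1)" "norm ((inv\<^bsub>SL2H\<^esub> h)$2$2) = norm (h$1$1)"
      by (simp_all add: SL2H_inverse_norms[OF inv_SL2H(1)])
    from assms(2)[OF inv] n show ?case
      unfolding diag2_def antidiag2_def by (metis norm_eq_zero)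
  next
    case (eng h1 h2)
    then show ?case
      by (auto simp: SL2H_def matrix_matrix_mult_def sum_2 diag2_def antidiag2_def)
  qed
  then have "moebius A None \<in> {None, Some 0}" if "A \<in> generate SL2H H" for A
    using that by (fastforce simp: moebius_def diag2_def antidiag2_def Let_def)
  then have "(\<lambda>A. moebius A None) ` generate SL2H H \<subseteq> {None, Some 0}"
    by (rule image_subsetI)
  then have "finite ((\<lambda>A. moebius A None) ` generate SL2H H)"
    by (rule finite_subset) simp
  then show ?thesis
    unfolding elementary_def by (intro disjI2 exI)
qed

lemma norm_mat2_le:
  fixes A :: "quat^2^2"
  shows "norm A \<le> norm (A$1$1) + norm (A$1$2) + norm (A$2$1) + norm (A$2$2)"
proof -
  have l: "norm v \<le> norm (v$1) + norm (v$2)" for v :: "'b::real_normed_vector^2"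
    unfolding norm_vec_def using L2_set_le_sum[of UNIV "\<lambda>i. norm (v$i)"] by (simp add: sum_2)
  show ?thesis using l[of A] l[of "A$1"] l[of "A$2"] by linarith
qed

lemma tendsto_matrix_mult:
  fixes f g :: "'b \<Rightarrow> 'a::real_normed_algebra_1^'n^'n"
  assumes "(f \<longlongrightarrow> X) F" "(g \<longlongrightarrow> Y) F"
  shows "((\<lambda>x. f x ** g x) \<longlongrightarrow> X ** Y) F"
  unfolding matrix_matrix_mult_def using assms
  by (intro tendsto_vec_lambda tendsto_sum tendsto_mult tendsto_vec_nth)

text \<open>On a convergent subsequence, \<open>X\<^sub>n\<^sup>-\<^sup>1 X\<^bsub>n+1\<^esub>\<close> tends to the identity, which is isolated.\<close>

lemma discrete_subgroup_eventually_const: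
  fixes X :: "nat \<Rightarrow> quat^2^2"
  assumes G: "subgroup G SL2H" and "discrete G" and X: "\<And>n. X n \<in> G"
    and bound: "\<And>n i j. norm (X n $ i $ j) \<le> C"
  obtains r :: "nat \<Rightarrow> nat" and N where "strict_mono r" "\<And>n. n \<ge> N \<Longrightarrow> X (r n) = X (r N)"
proof -
  interpret group SL2H by (rule group_SL2H)
  define Y where "Y n = inv\<^bsub>SL2H\<^esub> (X n)" for n
  have det: "qdet (X n) = 1" for n
    using X subgroup.subset[OF G] by (auto simp: SL2H_def)
  have XY: "X n ** Y n = mat 1" for n
    unfolding Y_def by (rule inv_SL2H[OF det])
  have YX: "Y n ** X n = mat 1" for n
    by (rule SL2H_inverse_commute[OF XY det])
  note n = SL2H_inverse_norms[OF XY det]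
  \<comment> \<open>Pairing each matrix with its inverse yields one subsequence along which both
    converge. The inverse has the same entry norms in another order, hence two times four
    entries.\<close>
  have "norm (X n, Y n) \<le> 8 * C" for n
  proof -
    have "norm (X n, Y n) \<le> norm (X n) + norm (Y n)" by (rule norm_Pair_le)
    also have "\<dots> \<le> 8 * C"
      using norm_mat2_le[of "X n"] norm_mat2_le[of "Y n"] bound[of n] unfolding n
      by (smt (verit))
    finally show ?thesis .
  qed
  then have "bounded (range (\<lambda>n. (X n, Y n)))"
    by (auto simp: bounded_iff)
  then obtain L r where r: "strict_mono r" and XYL: "((\<lambda>n. (X n, Y n)) \<circ> r) \<longlonglongrightarrow> L"
    using bounded_imp_convergent_subsequence by blast
  have XL: "(\<lambda>n. X (r n)) \<longlonglongrightarrow> fst L" and YL: "(\<lambda>n. Y (r n)) \<longlonglongrightarrow> snd L"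
    using tendsto_fst[OF XYL] tendsto_snd[OF XYL] by (simp_all add: o_def)
  have "(\<lambda>n. Y (r n) ** X (r n)) \<longlonglongrightarrow> snd L ** fst L"
    by (rule tendsto_matrix_mult[OF YL XL])
  then have one: "snd L ** fst L = mat 1"
    by (simp add: YX LIMSEQ_const_iff)
  have "mat 1 isolated_in G"
    using \<open>discrete G\<close> subgroup.one_closed[OF G] by (auto simp: discrete_def SL2H_def)
  then obtain e where e: "e > 0" "\<And>Z. Z \<in> G \<Longrightarrow> dist (mat 1) Z < e \<Longrightarrow> Z = mat 1"
    unfolding isolated_in_dist_Ex_iff by blast
  have "(\<lambda>n. Y (r n) ** X (r (Suc n))) \<longlonglongrightarrow> mat 1"
    using tendsto_matrix_mult[OF YL LIMSEQ_Suc[OF XL]] one by simp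
  then have "\<forall>\<^sub>F n in sequentially. dist (Y (r n) ** X (r (Suc n))) (mat 1) < e"
    using e(1) by (rule tendstoD)
  then obtain N where N: "\<And>n. n \<ge> N \<Longrightarrow> dist (Y (r n) ** X (r (Suc n))) (mat 1) < e"
    by (auto simp: eventually_sequentially)
  have step: "X (r (Suc n)) = X (r n)" if "n \<ge> N" for n
  proof -
    have "Y (r n) ** X (r (Suc n)) \<in> G"
      using subgroup.m_closed[OF G subgroup.m_inv_closed[OF G X] X, of "r n" "r (Suc n)"]
      by (simp add: Y_def SL2H_def)
    then have "Y (r n) ** X (r (Suc n)) = mat 1"
      using e(2) N[OF that] by (simp add: dist_commute)
    then have "X (r n) ** (Y (r n) ** X (r (Suc n))) = X (r n)" by simp
    then show ?thesis by (simp add: matrix_mul_assoc XY)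
  qed
  have "X (r n) = X (r N)" if "n \<ge> N" for n
    using that by (induction rule: dec_induct) (simp_all add: step)
  then show ?thesis by (rule that[OF r])
qed

section \<open>Real sequences that control the entries of the iterates\<close>

section \<open>The iteration\<close>

lemma LIMSEQ_0_if_ratio:
  fixes x :: "nat \<Rightarrow> real"
  assumes "q < 1" and "\<And>n. 0 \<le> x n" and "\<forall>\<^sub>F n in sequentially. x (Suc n) \<le> q * x n"
  shows "x \<longlonglongrightarrow> 0"
proof -
  obtain N where "\<And>n. n \<ge> N \<Longrightarrow> x (Suc n) \<le> q * x n"
    using assms(3) by (auto simp: eventually_sequentially)
  then show ?thesis
    using assms(1,2) by (intro summable_LIMSEQ_zero summable_ratio_test[of q N]) auto
qed

lemma Bseq_if_Suc_le_convergent: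
  fixes x y :: "nat \<Rightarrow> real"
  assumes "\<And>n. 0 \<le> x n" and "\<And>n. x (Suc n) \<le> y n" and "y \<longlonglongrightarrow> L"
  shows "Bseq x"
proof -
  have "Bseq y"
    using assms(3) by (intro convergent_imp_Bseq convergentI)
  then obtain K where "\<And>n. \<bar>y n\<bar> \<le> K"
    unfolding Bseq_def by auto
  then have "norm (x (Suc n)) \<le> K" for n
    using assms(1)[of "Suc n"] assms(2)[of n] by (smt (verit) real_norm_def)
  then have "Bseq (\<lambda>n. x (Suc n))"
    by (rule BseqI')
  then show ?thesis by (simp add: Bseq_Suc_iff)
qed

text \<open>As \<open>t\<close> tends to 0, \<open>y\<close> is asymptotically at most
  \<open>l\<close>, so \<open>x\<close> eventually grows by a factor strictly below \<open>l\<close>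
  per step.\<close>

lemma LIMSEQ_0_scaled:
  fixes x y t :: "nat \<Rightarrow> real"
  assumes "0 < l" "0 \<le> k" "k < 1" and x: "\<And>n. 0 \<le> x n" and t: "t \<longlonglongrightarrow> 0"
    and y: "\<And>n. y (Suc n) \<le> l * (1 + t n) + m * t n"
    and step: "\<And>n. x (Suc n) \<le> k * y n * x n"
  shows "(\<lambda>n. x n / l ^ n) \<longlonglongrightarrow> 0"
proof -
  have "(\<lambda>n. k * (l * (1 + t n) + m * t n)) \<longlonglongrightarrow> k * (l * (1 + 0) + m * 0)"
    by (intro tendsto_intros t)
  \<comment> \<open>The midpoint of \<open>k\<close> and 1 leaves room for the error terms in
    \<open>t n\<close> and still gives a ratio below 1.\<close>
  moreover have "k * (l * (1 + 0) + m * 0) < (1 + k) / 2 * l"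
    using assms(1,3) by simp
  ultimately have "\<forall>\<^sub>F n in sequentially. k * (l * (1 + t n) + m * t n) < (1 + k) / 2 * l"
    by (rule order_tendstoD)
  then have "\<forall>\<^sub>F n in sequentially. k * y (Suc n) \<le> (1 + k) / 2 * l"
  proof eventually_elim
    case (elim n)
    then show ?case using mult_left_mono[OF y[of n] \<open>0 \<le> k\<close>] by linarith
  qed
  \<comment> \<open>The hypothesis bounds \<open>y\<close> only from index 1 on: the initial matrix
    is arbitrary, and only later ones are conjugates.\<close>
  then have ev: "\<forall>\<^sub>F n in sequentially. k * y n \<le> (1 + k) / 2 * l"
    by (simp only: eventually_sequentially_Suc [of "\<lambda>n. k * y n \<le> (1 + k) / 2 * l"])
  show ?thesis
  proof (rule LIMSEQ_0_if_ratio[where q = "(1 + k) / 2"])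
    show "\<forall>\<^sub>F n in sequentially. x (Suc n) / l ^ Suc n \<le> (1 + k) / 2 * (x n / l ^ n)"
      using ev
    proof eventually_elim
      case (elim n)
      have "x (Suc n) \<le> (1 + k) / 2 * l * x n"
        using step[of n] mult_right_mono[OF elim x[of n]] by linarith
      then show ?case
        using \<open>0 < l\<close> by (simp add: field_simps)
    qed
  qed (use assms in auto)
qed

text \<open>Multiplying the two recursions and using \<open>ad\<close> gives
  \<open>t (Suc n)\<close> \<le> \<open>k\<^sup>2 * (1 + t n) * t n\<close> for the product
  \<open>t\<close>. The smallness assumption makes the initial factor less than 1.\<close>

lemma offdiag_product_LIMSEQ_0:
  fixes b c :: "nat \<Rightarrow> real"
  assumes k: "0 \<le> k" and small: "k\<^sup>2 * (1 + b 0 * c 0) < 1"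
    and nn: "\<And>n. 0 \<le> a n" "\<And>n. 0 \<le> b n" "\<And>n. 0 \<le> c n" "\<And>n. 0 \<le> d n"
    and ad: "\<And>n. a n * d n \<le> 1 + b n * c n"
    and b: "\<And>n. b (Suc n) \<le> k * a n * b n" and c: "\<And>n. c (Suc n) \<le> k * d n * c n"
  shows "(\<lambda>n. b n * c n) \<longlonglongrightarrow> 0"
proof -
  define t where "t n = b n * c n" for n
  have t0: "0 \<le> t n" for n by (simp add: t_def nn)
  have step: "t (Suc n) \<le> k\<^sup>2 * (1 + t n) * t n" for n
  proof -
    have "t (Suc n) \<le> (k * a n * b n) * (k * d n * c n)"
      unfolding t_def by (intro mult_mono b c) (simp_all add: nn k)
    also have "\<dots> = k\<^sup>2 * t n * (a n * d n)"
      by (simp add: t_def power2_eq_square)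
    also have "\<dots> \<le> k\<^sup>2 * t n * (1 + t n)"
      using ad[of n] t0[of n] by (intro mult_left_mono) (simp_all add: t_def)
    finally show ?thesis by (simp add: mult_ac)
  qed
  define \<rho> where "\<rho> = k\<^sup>2 * (1 + t 0)"
  have \<rho>: "0 \<le> \<rho>" "\<rho> < 1"
    using t0 small by (simp_all add: \<rho>_def t_def)
  \<comment> \<open>The uniform ratio is available only while \<open>t n\<close> has not exceeded
    \<open>t 0\<close>; the induction that follows shows that this persists.\<close>
  have le: "t (Suc n) \<le> \<rho> * t n" if "t n \<le> t 0" for n
  proof -
    have "k\<^sup>2 * (1 + t n) * t n \<le> \<rho> * t n"
      unfolding \<rho>_def using that t0 by (intro mult_right_mono mult_left_mono) auto
    with step[of n] show ?thesis by linarith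
  qed
  have "t n \<le> t 0" for n
  proof (induction n)
    case (Suc n)
    have "\<rho> * t n \<le> 1 * t n" using \<rho> t0 by (intro mult_right_mono) auto
    with le[OF Suc] Suc show ?case by linarith
  qed simp
  with le \<rho> t0 have "t \<longlonglongrightarrow> 0"
    by (intro LIMSEQ_0_if_ratio[of \<rho>]) auto
  then show ?thesis by (simp add: t_def [abs_def])
qed

section \<open>The contradiction from the iterates of \<open>S\<close>\<close>

theorem theorem3p1:
  fixes S T :: "quat^2^2" and a b c d lam mu :: quat
  assumes "S = mat2 a b c d" and "T = mat2 lam 0 0 mu"
    and "S \<in> carrier SL2H" and "T \<in> carrier SL2H"
    and "\<not> qsimilar lam mu"
    and "discrete (generate SL2H {S, T})"
    and "\<not> elementary (generate SL2H {S, T})"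
  shows "((qRe lam - qRe mu)\<^sup>2 + (norm (qIm lam) + norm (qIm mu))\<^sup>2) * (1 + norm (b * c)) \<ge> 1"
proof (rule ccontr)
  assume "\<not> ?thesis"
  then have small: "conj_gap lam mu * (1 + norm b * norm c) < 1"
    by (simp add: conj_gap_def norm_mult)
  \<comment> \<open>The gap alone is below 1; this gives \<open>k < 1\<close> for the individual
    off-diagonal entries and later excludes antidiagonal iterates.\<close>
  moreover have "conj_gap lam mu \<le> conj_gap lam mu * (1 + norm b * norm c)"
    using mult_left_mono[OF _ conj_gap_nonneg, of 1 "1 + norm b * norm c"] by simp
  ultimately have gap: "conj_gap lam mu < 1" by linarith
  interpret group SL2H by (rule group_SL2H)
  let ?G = "generate SL2H {S, T}"
  define k where "k = sqrt (conj_gap lam mu)"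
  have k: "0 \<le> k" "k < 1" "k\<^sup>2 = conj_gap lam mu"
    using gap by (simp_all add: k_def conj_gap_nonneg)
  have sub: "subgroup ?G SL2H"
    using assms(3,4) by (intro generate_is_subgroup) simp
  have ST: "S \<in> ?G" "T \<in> ?G"
    by (auto intro: generate.incl)
  have det: "qdet A = 1" if "A \<in> ?G" for A
    using that subgroup.subset[OF sub] by (auto simp: SL2H_def)
  have G_mult: "A ** B \<in> ?G" if "A \<in> ?G" "B \<in> ?G" for A B
    using generate.eng[OF that] by (simp add: SL2H_def)
  have G_inv: "inv\<^bsub>SL2H\<^esub> A \<in> ?G" if "A \<in> ?G" for A
    using that by (rule subgroup.m_inv_closed[OF sub])
  have lm: "norm lam * norm mu = 1"
    using det[OF ST(2)] unfolding assms(2) qdet_mat2 qdet2_def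
    by (simp flip: power_mult_distrib)
  have nz: "lam \<noteq> 0" "mu \<noteq> 0"
    using lm by force+

  define W where "W = rec_nat S (\<lambda>_ A. A ** T ** inv\<^bsub>SL2H\<^esub> A)"
  have W_0: "W 0 = S" and W_Suc: "W (Suc n) = W n ** mat2 lam 0 0 mu ** inv\<^bsub>SL2H\<^esub> (W n)" for n
    unfolding W_def assms(2) by simp_all
  have WG: "W n \<in> ?G" for n
    by (induction n) (auto simp: W_0 W_Suc ST G_mult G_inv simp flip: assms(2))
  note Wdet = det[OF WG]
  note Winv = inv_SL2H(1)[OF Wdet]
  let ?a = "\<lambda>n. norm (W n$1$1)" and ?b = "\<lambda>n. norm (W n$1$2)"
    and ?c = "\<lambda>n. norm (W n$2$1)" and ?d = "\<lambda>n. norm (W n$2$2)"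
  note bounds = conj_diag_bounds[OF Winv Wdet, of _ lam mu, folded W_Suc k_def]

  have t0: "(\<lambda>n. ?b n * ?c n) \<longlonglongrightarrow> 0"
    by (rule offdiag_product_LIMSEQ_0[where k = k and a = ?a and d = ?d])
      (use small k bounds SL2H_diag_le[OF Wdet] in \<open>auto simp: W_0 assms(1)\<close>)
  \<comment> \<open>The upper right entry is multiplied at each step by at most \<open>k\<close>
    times the upper left one, asymptotically at most |lam| in norm. The lower row behaves likewise
    with |mu|.\<close>
  have b0: "(\<lambda>n. ?b n / norm lam ^ n) \<longlonglongrightarrow> 0"
    by (rule LIMSEQ_0_scaled[OF _ k(1,2) _ t0, where y = ?a and m = "norm mu"])
      (use bounds nz in auto)
  have c0: "(\<lambda>n. ?c n / norm mu ^ n) \<longlonglongrightarrow> 0"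
    by (rule LIMSEQ_0_scaled[OF _ k(1,2) _ t0, where y = ?d and m = "norm lam"])
      (use bounds nz in \<open>auto simp: add.commute\<close>)
  have Ba: "Bseq ?a"
    by (rule Bseq_if_Suc_le_convergent[where x = ?a and L = "norm lam * (1 + 0) + norm mu * 0",
          OF norm_ge_zero bounds(3)])
      (intro tendsto_intros t0)
  have Bd: "Bseq ?d"
    by (rule Bseq_if_Suc_le_convergent[where x = ?d and L = "norm lam * 0 + norm mu * (1 + 0)",
          OF norm_ge_zero bounds(4)])
      (intro tendsto_intros t0)
  from b0 c0 have Bb: "Bseq (\<lambda>n. ?b n / norm lam ^ n)" "Bseq (\<lambda>n. ?c n / norm mu ^ n)"
    by (blast intro: convergent_imp_Bseq convergentI)+
  from Ba Bd Bb obtain C where C: "\<And>n. ?a n \<le> C" "\<And>n. ?d n \<le> C"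
    "\<And>n. ?b n / norm lam ^ n \<le> C" "\<And>n. ?c n / norm mu ^ n \<le> C"
  proof -
    from Ba Bd Bb obtain C1 C2 C3 C4 where "\<forall>n. norm (?a n) \<le> C1" "\<forall>n. norm (?d n) \<le> C2"
      "\<forall>n. norm (?b n / norm lam ^ n) \<le> C3" "\<forall>n. norm (?c n / norm mu ^ n) \<le> C4"
      unfolding Bseq_def by blast
    then show ?thesis
      by (intro that[of "max (max C1 C2) (max C3 C4)"]) (simp_all add: le_max_iff_disj)
  qed

  define D where "D n = mat2 (lam ^ n) 0 0 (mu ^ n)" for n
  define D' where "D' n = mat2 (inverse lam ^ n) 0 0 (inverse mu ^ n)" for n
  \<comment> \<open>The index \<open>2 * n\<close> matches the power \<open>n\<close>: since |lam|
    |mu| = 1, conjugation by \<open>D n\<close> scales the off-diagonal norms by |mu|^n / |lam|^n =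
    |lam|^(-2n) and by |mu|^(-2n), and keeps the diagonal norms.\<close>
  define U where "U n = D' n ** W (2 * n) ** D n" for n
  have DG: "D n \<in> ?G" for n
  proof (induction n)
    case 0
    show ?case using generate.one[of SL2H] by (simp add: D_def SL2H_def mat2_one)
  next
    case (Suc n)
    have "D (Suc n) = T ** D n" by (simp add: D_def assms(2) mat2_mult)
    then show ?case using G_mult[OF ST(2) Suc] by simp
  qed
  have "D' n ** D n = mat 1" for n
    using nz by (simp add: D_def D'_def mat2_mult mat2_one power_inverse)
  then have "D' n = inv\<^bsub>SL2H\<^esub> (D n)" for n
    by (metis inv_SL2H(1) DG det matrix_mul_assoc matrix_mul_lid matrix_mul_rid)
  then have UG: "U n \<in> ?G" for n
    unfolding U_def by (intro G_mult WG) (simp_all add: DG G_inv)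
  have inv_norm: "inverse (norm lam) = norm mu" "inverse (norm mu) = norm lam"
    using lm by (metis inverse_unique mult.commute)+
  have U: "U n = mat2 (inverse lam ^ n * W (2*n)$1$1 * lam ^ n) (inverse lam ^ n * W (2*n)$1$2 * mu ^ n)
        (inverse mu ^ n * W (2*n)$2$1 * lam ^ n) (inverse mu ^ n * W (2*n)$2$2 * mu ^ n)" for n
  proof -
    have "U n = D' n ** mat2 (W (2*n)$1$1) (W (2*n)$1$2) (W (2*n)$2$1) (W (2*n)$2$2) ** D n"
      by (simp only: U_def mat2_collapse)
    then show ?thesis by (simp add: D_def D'_def mat2_mult)
  qed
  have norm_U: "norm (U n$1$1) = ?a (2*n)" "norm (U n$2$2) = ?d (2*n)"
    "norm (U n$1$2) = ?b (2*n) / norm lam ^ (2*n)" "norm (U n$2$1) = ?c (2*n) / norm mu ^ (2*n)" for n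
  proof -
    have *: "norm lam ^ n * norm mu ^ n = 1" by (simp add: lm flip: power_mult_distrib)
    show "norm (U n$1$1) = ?a (2*n)" "norm (U n$2$2) = ?d (2*n)"
      using * by (simp_all add: U norm_mult norm_power norm_inverse inv_norm mult_ac)
    have "norm (U n$1$2) = ?b (2*n) * norm mu ^ (2*n)" "norm (U n$2$1) = ?c (2*n) * norm lam ^ (2*n)"
      by (simp_all add: U norm_mult norm_power norm_inverse inv_norm mult_2 power_add)
    then show "norm (U n$1$2) = ?b (2*n) / norm lam ^ (2*n)"
      "norm (U n$2$1) = ?c (2*n) / norm mu ^ (2*n)"
      by (simp_all add: divide_inverse inv_norm flip: power_inverse)
  qed
  have U_le: "norm (U n $ i $ j) \<le> C" for n i j
    using exhaust_2[of i] exhaust_2[of j] C[of "2*n"] by (auto simp: norm_U)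
  obtain r :: "nat \<Rightarrow> nat" and N where r: "strict_mono r" and const: "\<And>n. n \<ge> N \<Longrightarrow> U (r n) = U (r N)"
    using discrete_subgroup_eventually_const[where X = U, OF sub assms(6) UG U_le] by blast
  have r2: "strict_mono (\<lambda>n. 2 * r n)"
    using r by (simp add: strict_mono_def)
  \<comment> \<open>Eventual constancy upgrades convergence to zero to exact vanishing.\<close>
  have const_0: "f (U (r N)) = 0" if "(\<lambda>n. f (U (r n))) \<longlonglongrightarrow> 0" for f :: "_ \<Rightarrow> real"
  proof -
    have "(\<lambda>n. f (U (r n))) \<longlonglongrightarrow> f (U (r N))"
      by (rule tendsto_eventually, rule eventually_mono [OF eventually_ge_at_top [of N]])
        (rule arg_cong [OF const])
    with that show ?thesis by (rule LIMSEQ_unique[symmetric])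
  qed
  have "norm (U (r N)$1$2) = 0" "norm (U (r N)$2$1) = 0"
    using const_0[of "\<lambda>A. norm (A$1$2)"] const_0[of "\<lambda>A. norm (A$2$1)"]
      LIMSEQ_subseq_LIMSEQ[OF b0 r2] LIMSEQ_subseq_LIMSEQ[OF c0 r2]
    unfolding norm_U o_def by blast+
  then have W_diag: "diag2 (W (2 * r N))"
    using nz by (simp add: norm_U diag2_def)
  \<comment> \<open>Descent along the iteration. The antidiagonal case is excluded only for positive
    indices, where \<open>W n\<close> is a conjugate of \<open>T\<close>; at index 0 it is one of
    the allowed conclusions.\<close>
  have "diag2 S \<or> antidiag2 S" if "diag2 (W n)" for n
    using that
  proof (induction n)
    case (Suc n)
    have "diag2 (W n) \<or> antidiag2 (W n)"
      using conj_diag_diag2[OF Winv Wdet assms(5)] Suc.prems by (simp add: W_Suc)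
    moreover have "\<not> antidiag2 (W n)" if "n = Suc m" for m
      using conj_diag_not_antidiag2[OF Winv Wdet lm gap, of m] by (simp add: that W_Suc)
    ultimately show ?case
      using Suc.IH by (cases n) (auto simp: W_0)
  qed (simp add: W_0)
  then have "diag2 S \<or> antidiag2 S" using W_diag by blast
  then have "elementary ?G"
    using assms(3,4) by (intro elementary_generate_diag_antidiag) (auto simp: assms(2) diag2_def)
  with assms(7) show False by contradiction
qed

end
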